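(* Suppose the assumptions (A1)–(A5) listed in the context hold and that $\beta>\alpha$. Let $\mathbf{X}=(X_1,\dots,X_n)$ and $\mathbf{Y}=(Y_1,\dots,Y_n)$ be random vectors of $\mathbb{X}^n$, each with independent components of law $\mu$. Let $\widehat{\mathcal S}=\widehat{\mathcal S}_{\mathbf X}$ and $\widetilde{\mathcal S}=\widehat{\mathcal S}_{\mathbf Y}$ be the sets of minimizers of the empirical risks associated with $\mathbf{X}$ and $\mathbf{Y}$ respectively. Then, conditionally on the event $\mathbf{X}\in\mathcal{A},\ \mathbf{Y}\in\mathcal{A}$, $$\vartheta(\widetilde{\mathcal S};\widehat{\mathcal S})^{\beta-\alpha}\le\frac{2}{\tau}\,\frac1n\sum_{i=1}^n a(X_i,Y_i).$$
   Context: Setting. $(\mathbb{X},\rho,\mu)$ is a metric probability space (Borel $\sigma$-algebra) and $(\mathcal M,\vartheta)$ a metric space. $l:\mathcal M\times\mathbb{X}\to\mathbb{R}$ is such that for every $\phi\in\mathcal M$, $l(\phi,\cdot)$ is measurable and $\mathbb{E}_{X\sim\mu}|l(\phi,X)|<\infty$; $\mathcal R:\mathcal M\to\mathbb{R}\cup\{+\infty\}$. The risk is $\mathcal J(\phi)=\mathbb{E}_{X\sim\mu}[l(\phi,X)]+\mathcal R(\phi)$; for $\mathbf{x}\in\mathbb{X}^n$ the empirical risk is $\widehat{\mathcal J}_{\mathbf x}(\phi)=\frac1n\sum_{i=1}^n l(\phi,x_i)+\mathcal R(\phi)$. $\mathcal S=\arg\min\mathcal J$, $\mathcal J_*=\min\mathcal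 J$, $\widehat{\mathcal S}_{\mathbf x}=\arg\min\widehat{\mathcal J}_{\mathbf x}$, $\widehat{\mathcal J}_{\mathbf x,*}=\min\widehat{\mathcal J}_{\mathbf x}$. For $\phi\in\mathcal M$ and $E,E'\subseteq\mathcal M$: $\vartheta(\phi,E)=\inf_{\psi\in E}\vartheta(\phi,\psi)$ and $\vartheta(E;E')=\sup_{\phi\in E}\vartheta(\phi,E')$. $[\mathcal J\le c]=\{\phi\in\mathcal M:\mathcal J(\phi)\le c\}$. A pseudometric satisfies the axioms of a metric except $a(x,y)=0\Rightarrow x=y$. $\|Z\|_{\psi_1}=\inf\{c>0:\mathbb{E}\exp(|Z|/c)\le2\}$, and for a pseudometric $a$ on $\mathbb{X}$, $\|a\|_{\psi_1}:=\|a(X,Y)\|_{\psi_1}$ with $X,Y\sim\mu$ independent. $\mathbf{X}=(X_1,\dots,X_n)$ has i.i.d. components of law $\mu$. Random quantities involved are assumed measurable. Assumptions. (A1) $\mathcal J$ is proper (not identically $+\infty$) and has at least one minimizer; for all $n\ge1$ and $\mu^n$-almost every $\mathbf{x}$, $\widehat{\mathcal J}_{\mathbf x}$ is proper with at least one minimizer, and its minimizers are measurable functions of $\mathbf{x}$. (A2) There are $\mathcal J_0\in(\mathcal J_*,+\infty]$, $\beta\ge1$, $\tau>0$ such that $\phi\in[\mathcal J\le\mathcal J_0]$ implies $\tau\,\vartheta(\phi,\mathcal S)^\beta\le\mathcal J(\phi)-\mathcal J_*$. (A3) There is $\eta:\mathbb{N}\to[0,1]$ with $\lim_{n\to\infty}\eta(n)=0$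 and $\mathbb{P}(\sup_{\widehat\phi\in\widehat{\mathcal S}_{\mathbf X}}\mathcal J(\widehat\phi)>\mathcal J_0)\le\eta(n)$. (A4) With $\widehat\tau_{\mathbf x}=\inf_{\mathbf y\in\mathrm{supp}(\mu)^n}\inf\left\{\frac{\widehat{\mathcal J}_{\mathbf x}(\phi)-\widehat{\mathcal J}_{\mathbf x,*}}{\vartheta(\phi,\widehat{\mathcal S}_{\mathbf x})^\beta}:\phi\in[\mathcal J\le\mathcal J_0]\cap\widehat{\mathcal S}_{\mathbf y}\right\}$ (points with $\vartheta(\phi,\widehat{\mathcal S}_{\mathbf x})=0$ disregarded), there is $\kappa:\mathbb{N}\to[0,1]$ with $\lim_{n\to\infty}\kappa(n)=0$ and $\mathbb{P}(\widehat\tau_{\mathbf X}<\tau/2)\le\kappa(n)$. (A5) There are $\alpha>0$, a pseudometric $a:\mathbb{X}\times\mathbb{X}\to\mathbb{R}_+$ with $\|a\|_{\psi_1}<\infty$, and $\Upsilon\subseteq\mathcal M$ with $\mathcal S\subseteq\Upsilon$ such that for all $\phi,\psi\in\Upsilon$ and $\mu$-almost every $x,y\in\mathbb{X}$, $l(\phi,x)-l(\psi,x)-l(\phi,y)+l(\psi,y)\le a(x,y)\,\vartheta(\phi,\psi)^\alpha$; moreover there is $\iota:\mathbb{N}\to[0,1]$ with $\lim_{n\to\infty}\iota(n)=0$ and $\mathbb{P}(\widehat{\mathcal S}_{\mathbf X}\not\subset\Upsilon)\le\iota(n)$. The set $\mathcal A\subseteq\mathbb{X}^n$ is $\mathcal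 A=\{\mathbf{x}:\sup_{\widehat\phi\in\widehat{\mathcal S}_{\mathbf x}}\mathcal J(\widehat\phi)\le\mathcal J_0,\ \widehat\tau_{\mathbf x}\ge\tau/2,\ \widehat{\mathcal S}_{\mathbf x}\subseteq\Upsilon\}$.
   Formalization: It is assumed that supp(μ) has full μ-measure (automatic for separable 𝕏), and the inequality in (A5) is required for all x,y outside one μ-null set not depending on φ,ψ; if that null set may depend on φ,ψ, the claim is false. *)

theory Defs
  imports "HOL-Probability.Probability"
begin

text \<open>
  Throughout, \<open>l \<phi> x\<close> is the loss of \<open>\<phi>\<close> at the data point \<open>x\<close> and \<open>R \<phi> \<in> \<real> \<union> {+\<infinity>}\<close> is the
  regularizer. A sample of size \<open>n\<close> is a function on the index set \<open>{..<n}\<close>.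
\<close>

definition sample_measure :: "'x measure \<Rightarrow> nat \<Rightarrow> (nat \<Rightarrow> 'x) measure" where
  "sample_measure \<mu> n = (\<Pi>\<^sub>M i\<in>{..<n}. \<mu>)"

definition risk :: "'x measure \<Rightarrow> ('m \<Rightarrow> 'x \<Rightarrow> real) \<Rightarrow> ('m \<Rightarrow> ereal) \<Rightarrow> 'm \<Rightarrow> ereal" where
  "risk \<mu> l R \<phi> = ereal (\<integral>x. l \<phi> x \<partial>\<mu>) + R \<phi>"

definition emp_risk ::
  "('m \<Rightarrow> 'x \<Rightarrow> real) \<Rightarrow> ('m \<Rightarrow> ereal) \<Rightarrow> nat \<Rightarrow> (nat \<Rightarrow> 'x) \<Rightarrow> 'm \<Rightarrow> ereal" where
  "emp_risk l R n x \<phi> = ereal ((1 / real n) * (\<Sum>i<n. l \<phi> (x i))) + R \<phi>"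

definition minimizers :: "('m \<Rightarrow> ereal) \<Rightarrow> 'm set" where
  "minimizers F = {\<phi>. is_arg_min F (\<lambda>_. True) \<phi>}"

text \<open>The infimum of \<open>F\<close>, which is the minimum as soon as \<open>minimizers F\<close> is nonempty.\<close>

definition min_value :: "('m \<Rightarrow> ereal) \<Rightarrow> ereal" where
  "min_value F = (INF \<phi>. F \<phi>)"

definition proper :: "('m \<Rightarrow> ereal) \<Rightarrow> bool" where
  "proper F \<longleftrightarrow> (\<exists>\<phi>. F \<phi> \<noteq> \<infinity>)"

abbreviation emp_minimizers ::
  "('m \<Rightarrow> 'x \<Rightarrow> real) \<Rightarrow> ('m \<Rightarrow> ereal) \<Rightarrow> nat \<Rightarrow> (nat \<Rightarrow> 'x) \<Rightarrow> 'm set" where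
  "emp_minimizers l R n x \<equiv> minimizers (emp_risk l R n x)"

text \<open>Unlike \<open>infdist\<close>, the distance to the empty set is \<open>+\<infinity>\<close>.\<close>

definition dist_to :: "'m::metric_space \<Rightarrow> 'm set \<Rightarrow> ereal" where
  "dist_to \<phi> E = (INF \<psi>\<in>E. ereal (dist \<phi> \<psi>))"

definition excess :: "'m::metric_space set \<Rightarrow> 'm set \<Rightarrow> ereal" where
  "excess E E' = (SUP \<phi>\<in>E. dist_to \<phi> E')"

text \<open>Power of an extended nonnegative number with a positive real exponent; it is only used in
  that range, where \<open>0\<close> is mapped to \<open>0\<close>.\<close>

definition epowr :: "ereal \<Rightarrow> real \<Rightarrow> ereal" where
  "epowr u p = (if u = \<infinity> then \<infinity> else ereal (real_of_ereal u powr p))"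

definition pseudometric :: "('x \<Rightarrow> 'x \<Rightarrow> real) \<Rightarrow> bool" where
  "pseudometric a \<longleftrightarrow>
     (\<forall>x y. 0 \<le> a x y) \<and> (\<forall>x. a x x = 0) \<and> (\<forall>x y. a x y = a y x) \<and>
     (\<forall>x y z. a x z \<le> a x y + a y z)"

definition psi1_norm :: "'w measure \<Rightarrow> ('w \<Rightarrow> real) \<Rightarrow> ereal" where
  "psi1_norm P Z =
     (INF c\<in>{c. 0 < c \<and> (\<integral>\<^sup>+\<omega>. ennreal (exp (\<bar>Z \<omega>\<bar> / c)) \<partial>P) \<le> 2}. ereal c)"

text \<open>Under the product measure the two coordinates are independent with law \<open>\<mu>\<close>.\<close>

definition psi1_pseudometric :: "'x measure \<Rightarrow> ('x \<Rightarrow> 'x \<Rightarrow> real) \<Rightarrow> ereal" where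
  "psi1_pseudometric \<mu> a = psi1_norm (\<mu> \<Otimes>\<^sub>M \<mu>) (\<lambda>(x, y). a x y)"

text \<open>If \<open>supp \<mu>\<close> has full measure, it is the smallest closed set of full measure. This is automatic
  on a separable metric space, but can fail on a nonseparable one.\<close>

definition supp :: "'x::topological_space measure \<Rightarrow> 'x set" where
  "supp \<mu> = {x. \<forall>U. open U \<and> x \<in> U \<longrightarrow> 0 < emeasure \<mu> U}"

text \<open>The random growth constant of the empirical risk; an infimum over no points is \<open>+\<infinity>\<close>.\<close>

definition emp_growth ::
  "'x::metric_space measure \<Rightarrow> ('m::metric_space \<Rightarrow> 'x \<Rightarrow> real) \<Rightarrow> ('m \<Rightarrow> ereal) \<Rightarrow> ereal \<Rightarrow> real
     \<Rightarrow> nat \<Rightarrow> (nat \<Rightarrow> 'x) \<Rightarrow> ereal" where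
  "emp_growth \<mu> l R J0 \<beta> n x =
     (INF y\<in>(\<Pi>\<^sub>E i\<in>{..<n}. supp \<mu>).
        INF \<phi>\<in>{\<phi> \<in> emp_minimizers l R n y. risk \<mu> l R \<phi> \<le> J0 \<and>
                   dist_to \<phi> (emp_minimizers l R n x) \<noteq> 0}.
          (emp_risk l R n x \<phi> - min_value (emp_risk l R n x)) /
          epowr (dist_to \<phi> (emp_minimizers l R n x)) \<beta>)"

definition good_samples ::
  "'x::metric_space measure \<Rightarrow> ('m::metric_space \<Rightarrow> 'x \<Rightarrow> real) \<Rightarrow> ('m \<Rightarrow> ereal) \<Rightarrow> ereal \<Rightarrow> real
     \<Rightarrow> real \<Rightarrow> 'm set \<Rightarrow> nat \<Rightarrow> (nat \<Rightarrow> 'x) set" where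
  "good_samples \<mu> l R J0 \<beta> \<tau> \<Upsilon> n =
     {x \<in> space (sample_measure \<mu> n).
        (SUP \<phi>\<in>emp_minimizers l R n x. risk \<mu> l R \<phi>) \<le> J0 \<and>
        ereal (\<tau> / 2) \<le> emp_growth \<mu> l R J0 \<beta> n x \<and>
        emp_minimizers l R n x \<subseteq> \<Upsilon>}"

text \<open>\<open>Q n\<close> is a measurable event of samples of size \<open>n\<close>, for every \<open>n \<ge> 1\<close>, with probability at
  most \<open>r n \<in> [0, 1]\<close>, where \<open>r\<close> vanishes at infinity. Measurability is part of the requirement
  because \<open>measure\<close> is \<open>0\<close> on nonmeasurable sets.\<close>

definition vanishing_prob :: "'x measure \<Rightarrow> (nat \<Rightarrow> (nat \<Rightarrow> 'x) \<Rightarrow> bool) \<Rightarrow> (nat \<Rightarrow> real) \<Rightarrow> bool" where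
  "vanishing_prob \<mu> Q r \<longleftrightarrow>
     (\<forall>n. 0 \<le> r n \<and> r n \<le> 1) \<and> r \<longlonglongrightarrow> 0 \<and>
     (\<forall>n\<ge>1. {x \<in> space (sample_measure \<mu> n). Q n x} \<in> sets (sample_measure \<mu> n) \<and>
             measure (sample_measure \<mu> n) {x \<in> space (sample_measure \<mu> n). Q n x} \<le> r n)"

end

theory Submission
  imports Defs
begin

text \<open>
  For \<open>\<phi>\<close> minimizing the empirical risk of \<open>y\<close> and \<open>\<psi>\<close> minimizing that of \<open>x\<close>, optimality of \<open>\<phi>\<close>
  makes the excess empirical risk of \<open>\<phi>\<close> for \<open>x\<close> at most a difference of four loss averages, which
  the regularity of the loss bounds by \<open>A dist(\<phi>, \<psi>)\<^sup>\<alpha>\<close>, where \<open>A\<close> is the average of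
  \<open>a (x i) (y i)\<close>. The growth of the empirical risk bounds the same excess from below by
  \<open>\<tau> / 2 d\<^sup>\<beta>\<close>, where \<open>d\<close> is the distance of \<open>\<phi>\<close> to the minimizers for \<open>x\<close>. Taking the infimum over
  \<open>\<psi>\<close> and dividing by \<open>d\<^sup>\<alpha>\<close> gives the claim.
\<close>

lemma mem_minimizers_iff: "\<phi> \<in> minimizers F \<longleftrightarrow> (\<forall>\<psi>. F \<phi> \<le> F \<psi>)"
  by (auto simp: minimizers_def is_arg_min_def not_less)

lemma min_value_eq:
  assumes "\<phi> \<in> minimizers F"
  shows "min_value F = F \<phi>"
  using assms unfolding min_value_def mem_minimizers_iff
  by (intro antisym INF_lower INF_greatest) auto

text \<open>The average loss is real, so \<open>emp_risk\<close> can be infinite only through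
  \<open>R\<close>, and properness makes the minimal value differ from \<open>\<infinity>\<close>.
  This turns the differences of empirical risks below into differences of reals.\<close>

lemma minimizers_emp_risk_finite:
  assumes "\<phi> \<in> emp_minimizers l R n x" "proper (emp_risk l R n x)" "R \<phi> \<noteq> -\<infinity>"
  shows "\<bar>R \<phi>\<bar> \<noteq> \<infinity>"
proof -
  obtain \<psi> where \<psi>: "emp_risk l R n x \<psi> \<noteq> \<infinity>"
    using assms(2) by (auto simp: proper_def)
  have "emp_risk l R n x \<phi> \<le> emp_risk l R n x \<psi>"
    using assms(1) by (simp add: mem_minimizers_iff)
  with \<psi> have "emp_risk l R n x \<phi> \<noteq> \<infinity>" by auto
  with assms(3) show ?thesis by (cases "R \<phi>") (auto simp: emp_risk_def)
qed

text \<open>Away from the empty set the two conventions agree, which gives access to the real-valued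
  theory of \<open>infdist\<close>.\<close>

lemma dist_to_eq_infdist:
  assumes "E \<noteq> {}"
  shows "dist_to \<phi> E = ereal (infdist \<phi> E)"
proof (rule antisym)
  show "ereal (infdist \<phi> E) \<le> dist_to \<phi> E"
    unfolding dist_to_def by (intro INF_greatest) (simp add: infdist_le)
  have "\<bar>dist_to \<phi> E\<bar> \<noteq> \<infinity>"
  proof -
    obtain \<psi> where "\<psi> \<in> E" using assms by auto
    then have "dist_to \<phi> E \<le> ereal (dist \<phi> \<psi>)" unfolding dist_to_def by (rule INF_lower)
    moreover have "0 \<le> dist_to \<phi> E" unfolding dist_to_def by (intro INF_greatest) simp
    ultimately show ?thesis by auto
  qed
  then obtain r where r: "dist_to \<phi> E = ereal r" by auto
  have "r \<le> dist \<phi> \<psi>" if "\<psi> \<in> E" for \<psi>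
    using INF_lower[OF that, of "\<lambda>\<psi>. ereal (dist \<phi> \<psi>)"] r by (simp add: dist_to_def)
  then have "r \<le> infdist \<phi> E"
    using assms by (simp add: infdist_notempty cINF_greatest)
  with r show "dist_to \<phi> E \<le> ereal (infdist \<phi> E)" by simp
qed

text \<open>Moving the exponent to the real side allows the supremum in \<open>excess\<close> to be
  bounded point by point, with no continuity of \<open>epowr\<close> along suprema.\<close>

lemma epowr_le:
  assumes "0 \<le> u" "u \<le> ereal (A powr (1 / p))" "0 < p" "0 \<le> A"
  shows "epowr u p \<le> ereal A"
proof -
  obtain r where r: "u = ereal r" "0 \<le> r" "r \<le> A powr (1 / p)"
    using assms(1,2) by (cases u) auto
  have "r powr p \<le> (A powr (1 / p)) powr p"
    using r assms(3) by (intro powr_mono2) auto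
  also have "\<dots> = A" using assms(3,4) by (simp add: powr_powr)
  finally show ?thesis using r by (simp add: epowr_def)
qed

text \<open>The infimum defining \<open>infdist\<close> need not be attained. Inverting the power
  turns the hypothesis into a lower bound on \<open>dist \<phi> \<psi>\<close> that is uniform in
  \<open>\<psi>\<close>; it passes to the infimum and is then raised back to the power
  \<open>\<alpha>\<close>.\<close>

lemma le_mult_infdist_powr:
  assumes "E \<noteq> {}" "0 < \<alpha>" "0 \<le> A" "0 \<le> B"
    and le: "\<And>\<psi>. \<psi> \<in> E \<Longrightarrow> B \<le> A * dist \<phi> \<psi> powr \<alpha>"
  shows "B \<le> A * infdist \<phi> E powr \<alpha>"
\<comment> \<open>The inversion divides by \<open>A\<close>. If \<open>A = 0\<close>, any point of
  the nonempty \<open>E\<close> already gives \<open>B \<le> 0\<close>.\<close>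
proof (cases "A = 0")
  case True
  then show ?thesis using assms by auto
next
  case False
  then have A: "0 < A" using assms by simp
  have "(B / A) powr (1 / \<alpha>) \<le> dist \<phi> \<psi>" if "\<psi> \<in> E" for \<psi>
  proof -
    have "B / A \<le> dist \<phi> \<psi> powr \<alpha>"
      using le[OF that] A by (simp add: field_simps)
    then have "(B / A) powr (1 / \<alpha>) \<le> (dist \<phi> \<psi> powr \<alpha>) powr (1 / \<alpha>)"
      using assms A by (intro powr_mono2) auto
    then show ?thesis using assms(2) by (simp add: powr_powr)
  qed
  then have "(B / A) powr (1 / \<alpha>) \<le> infdist \<phi> E"
    using assms(1) by (simp add: infdist_notempty cINF_greatest)
  then have "((B / A) powr (1 / \<alpha>)) powr \<alpha> \<le> infdist \<phi> E powr \<alpha>"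
    using assms(2) by (intro powr_mono2) auto
  then have "B / A \<le> infdist \<phi> E powr \<alpha>"
    using assms A by (simp add: powr_powr)
  then show ?thesis using A by (simp add: field_simps)
qed

text \<open>Subtracting the nonpositive difference of the risks of \<open>\<phi>\<close> and
  \<open>\<psi>\<close> for \<open>y\<close> can only increase the left side. The regularizers then
  cancel and leave an average of the four-term differences of losses.\<close>

lemma emp_risk_cross_difference_le:
  assumes finite: "\<bar>R \<phi>\<bar> \<noteq> \<infinity>" "\<bar>R \<psi>\<bar> \<noteq> \<infinity>"
    and min: "emp_risk l R n y \<phi> \<le> emp_risk l R n y \<psi>"
    and lip: "\<And>i. i < n \<Longrightarrow>
      l \<phi> (x i) - l \<psi> (x i) - l \<phi> (y i) + l \<psi> (y i) \<le> a (x i) (y i) * D"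
  shows "emp_risk l R n x \<phi> - emp_risk l R n x \<psi>
    \<le> ereal ((1 / real n) * (\<Sum>i<n. a (x i) (y i)) * D)"
proof -
  obtain u v where R: "R \<phi> = ereal u" "R \<psi> = ereal v"
    using finite by auto
  have "(\<Sum>i<n. l \<phi> (x i) - l \<psi> (x i) - l \<phi> (y i) + l \<psi> (y i)) \<le> (\<Sum>i<n. a (x i) (y i) * D)"
    using lip by (intro sum_mono) auto
  then have "(1 / real n) * ((\<Sum>i<n. l \<phi> (x i)) - (\<Sum>i<n. l \<psi> (x i))
      - (\<Sum>i<n. l \<phi> (y i)) + (\<Sum>i<n. l \<psi> (y i)))
    \<le> (1 / real n) * ((\<Sum>i<n. a (x i) (y i)) * D)"
    by (intro mult_left_mono) (auto simp: sum.distrib sum_subtractf sum_distrib_right)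
  with min show ?thesis
    by (simp add: emp_risk_def R algebra_simps diff_divide_distrib add_divide_distrib)
qed

text \<open>The infimum over samples in the support is specialized to the second sample
  \<open>y\<close>, whose minimizers are the points to be tested.\<close>

lemma emp_growth_le:
  assumes "\<phi> \<in> emp_minimizers l R n y" "y \<in> (\<Pi>\<^sub>E i\<in>{..<n}. supp \<mu>)" "risk \<mu> l R \<phi> \<le> J0"
    and "dist_to \<phi> (emp_minimizers l R n x) \<noteq> 0"
  shows "emp_growth \<mu> l R J0 \<beta> n x \<le> (emp_risk l R n x \<phi> - min_value (emp_risk l R n x)) /
    epowr (dist_to \<phi> (emp_minimizers l R n x)) \<beta>"
  unfolding emp_growth_def using assms by (intro INF_lower2[OF assms(2)] INF_lower) auto

text \<open>This is the theorem for two fixed samples; randomness only serves to provide these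
  hypotheses almost surely.\<close>

lemma excess_emp_minimizers_le:
  assumes x: "x \<in> good_samples \<mu> l R J0 \<beta> \<tau> \<Upsilon> n" and y: "y \<in> good_samples \<mu> l R J0 \<beta> \<tau> \<Upsilon> n"
    and supp: "y \<in> (\<Pi>\<^sub>E i\<in>{..<n}. supp \<mu>)"
    and nonempty: "emp_minimizers l R n x \<noteq> {}" "emp_minimizers l R n y \<noteq> {}"
    and proper: "proper (emp_risk l R n x)" "proper (emp_risk l R n y)"
    and reg: "\<And>\<phi>. R \<phi> \<noteq> -\<infinity>"
    and exponents: "0 < \<alpha>" "\<alpha> < \<beta>" and "0 < \<tau>" and a_nonneg: "\<And>x y. 0 \<le> a x y"
    and lip: "\<And>i \<phi> \<psi>. i < n \<Longrightarrow> \<phi> \<in> \<Upsilon> \<Longrightarrow> \<psi> \<in> \<Upsilon> \<Longrightarrow>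
      l \<phi> (x i) - l \<psi> (x i) - l \<phi> (y i) + l \<psi> (y i) \<le> a (x i) (y i) * dist \<phi> \<psi> powr \<alpha>"
  shows "epowr (excess (emp_minimizers l R n y) (emp_minimizers l R n x)) (\<beta> - \<alpha>)
    \<le> ereal (2 / \<tau> * ((1 / real n) * (\<Sum>i<n. a (x i) (y i))))"
proof -
  let ?S = "emp_minimizers l R n x" and ?T = "emp_minimizers l R n y"
  define A where "A = (1 / real n) * (\<Sum>i<n. a (x i) (y i))"
  have A: "0 \<le> A" by (auto simp: A_def intro!: sum_nonneg a_nonneg divide_nonneg_nonneg)
  have sub: "?S \<subseteq> \<Upsilon>" "?T \<subseteq> \<Upsilon>" using x y by (auto simp: good_samples_def)
  have dist_le: "dist_to \<phi> ?S \<le> ereal ((2 / \<tau> * A) powr (1 / (\<beta> - \<alpha>)))" if \<phi>: "\<phi> \<in> ?T" for \<phi>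
  \<comment> \<open>\<open>emp_growth\<close> says nothing about points at distance zero; for them
    the bound is trivial, its right side being nonnegative.\<close>
  proof (cases "infdist \<phi> ?S = 0")
    case True
    then show ?thesis using nonempty by (simp add: dist_to_eq_infdist)
  next
    case False
    define r where "r = infdist \<phi> ?S"
    have r: "0 < r" using False infdist_nonneg[of \<phi> ?S] by (simp add: r_def)
    have r_eq: "dist_to \<phi> ?S = ereal r" using nonempty by (simp add: dist_to_eq_infdist r_def)
    have "risk \<mu> l R \<phi> \<le> (SUP \<phi>\<in>?T. risk \<mu> l R \<phi>)" using \<phi> by (rule SUP_upper)
    also have "\<dots> \<le> J0" using y by (simp add: good_samples_def)
    finally have J0: "risk \<mu> l R \<phi> \<le> J0" .
    have "ereal (\<tau> / 2) \<le> emp_growth \<mu> l R J0 \<beta> n x" using x by (simp add: good_samples_def)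
    also have "\<dots> \<le> (emp_risk l R n x \<phi> - min_value (emp_risk l R n x)) / ereal (r powr \<beta>)"
      using emp_growth_le[OF \<phi> supp J0, of x \<beta>] r by (simp add: r_eq epowr_def)
    finally have "ereal (\<tau> / 2)
      \<le> (emp_risk l R n x \<phi> - min_value (emp_risk l R n x)) / ereal (r powr \<beta>)" .
    then have growth: "ereal (\<tau> / 2 * r powr \<beta>)
      \<le> emp_risk l R n x \<phi> - min_value (emp_risk l R n x)"
      using r by (simp add: ereal_le_divide_pos mult.commute)
    have "\<tau> / 2 * r powr \<beta> \<le> A * dist \<phi> \<psi> powr \<alpha>" if \<psi>: "\<psi> \<in> ?S" for \<psi>
    proof -
      have "emp_risk l R n x \<phi> - emp_risk l R n x \<psi> \<le> ereal (A * dist \<phi> \<psi> powr \<alpha>)"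
        unfolding A_def
      proof (rule emp_risk_cross_difference_le)
        show "\<bar>R \<phi>\<bar> \<noteq> \<infinity>" using minimizers_emp_risk_finite[OF \<phi> proper(2) reg] .
        show "\<bar>R \<psi>\<bar> \<noteq> \<infinity>" using minimizers_emp_risk_finite[OF \<psi> proper(1) reg] .
        show "emp_risk l R n y \<phi> \<le> emp_risk l R n y \<psi>"
          using \<phi> by (simp add: mem_minimizers_iff)
      qed (use lip \<phi> \<psi> sub in blast)
      \<comment> \<open>Every \<open>\<psi>\<close> in \<open>?S\<close> has the same minimal value,
        so one growth bound serves against all of them.\<close>
      with growth show ?thesis unfolding min_value_eq[OF \<psi>] using order_trans by fastforce
    qed
    then have "\<tau> / 2 * r powr \<beta> \<le> A * r powr \<alpha>"
      unfolding r_def using nonempty exponents A \<open>0 < \<tau>\<close>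
      by (intro le_mult_infdist_powr) auto
    \<comment> \<open>Division by \<open>r powr \<alpha>\<close> is legitimate because
      \<open>r > 0\<close>.\<close>
    then have "r powr (\<beta> - \<alpha>) \<le> 2 / \<tau> * A"
      using r \<open>0 < \<tau>\<close> by (simp add: powr_diff field_simps)
    then have "(r powr (\<beta> - \<alpha>)) powr (1 / (\<beta> - \<alpha>)) \<le> (2 / \<tau> * A) powr (1 / (\<beta> - \<alpha>))"
      using exponents by (intro powr_mono2) auto
    then show ?thesis using exponents r by (simp add: powr_powr r_eq)
  qed
  \<comment> \<open>A point of \<open>?T\<close> is needed for nonnegativity: the supremum over the
    empty set is \<open>-\<infinity>\<close>, outside the range intended for
    \<open>epowr\<close>.\<close>
  obtain \<phi> where \<phi>: "\<phi> \<in> ?T" using nonempty by auto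
  have "0 \<le> dist_to \<phi> ?S" using nonempty by (simp add: dist_to_eq_infdist infdist_nonneg)
  also have "\<dots> \<le> excess ?T ?S" unfolding excess_def using \<phi> by (rule SUP_upper)
  finally have "0 \<le> excess ?T ?S" .
  moreover have "excess ?T ?S \<le> ereal ((2 / \<tau> * A) powr (1 / (\<beta> - \<alpha>)))"
    unfolding excess_def by (intro SUP_least dist_le)
  ultimately show ?thesis
    unfolding A_def[symmetric] using exponents A \<open>0 < \<tau>\<close> by (intro epowr_le) auto
qed

text \<open>Independence makes the law of the whole vector the product measure, so almost sure
  properties of samples pull back to \<open>P\<close>.\<close>

lemma AE_sample:
  assumes "prob_space P" "n \<ge> 1"
    and "prob_space.indep_vars P (\<lambda>_. \<mu>) X {..<n}" "\<And>i. i < n \<Longrightarrow> distr P \<mu> (X i) = \<mu>"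
    and "AE x in sample_measure \<mu> n. Q x"
  shows "AE \<omega> in P. Q (\<lambda>i\<in>{..<n}. X i \<omega>)"
proof -
  interpret prob_space P by fact
  have rv: "X i \<in> P \<rightarrow>\<^sub>M \<mu>" if "i < n" for i
    using assms(3) that by (auto simp: indep_vars_def)
  have "distr P (\<Pi>\<^sub>M i\<in>{..<n}. \<mu>) (\<lambda>\<omega>. \<lambda>i\<in>{..<n}. X i \<omega>) = (\<Pi>\<^sub>M i\<in>{..<n}. distr P \<mu> (X i))"
    using assms(2,3) rv by (subst (asm) indep_vars_iff_distr_eq_PiM') (auto simp: lessThan_empty_iff)
  also have "\<dots> = sample_measure \<mu> n"
    unfolding sample_measure_def using assms(4) by (intro PiM_cong) auto
  finally have law: "distr P (\<Pi>\<^sub>M i\<in>{..<n}. \<mu>) (\<lambda>\<omega>. \<lambda>i\<in>{..<n}. X i \<omega>) = sample_measure \<mu> n" .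
  show ?thesis
  proof (rule AE_distrD[where P = Q])
    show "(\<lambda>\<omega>. \<lambda>i\<in>{..<n}. X i \<omega>) \<in> P \<rightarrow>\<^sub>M (\<Pi>\<^sub>M i\<in>{..<n}. \<mu>)"
      using rv by (intro measurable_restrict) auto
    show "AE x in distr P (\<Pi>\<^sub>M i\<in>{..<n}. \<mu>) (\<lambda>\<omega>. \<lambda>i\<in>{..<n}. X i \<omega>). Q x"
      unfolding law by (fact assms(5))
  qed
qed

text \<open>Each coordinate has law \<open>\<mu>\<close>, and finitely many almost sure events hold
  together.\<close>

lemma AE_sample_component:
  fixes n :: nat
  assumes "prob_space P"
    and "prob_space.indep_vars P (\<lambda>_. \<mu>) X {..<n}" "\<And>i. i < n \<Longrightarrow> distr P \<mu> (X i) = \<mu>"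
    and "AE x in \<mu>. Q x"
  shows "AE \<omega> in P. \<forall>i<n. Q (X i \<omega>)"
proof -
  interpret prob_space P by fact
  have "AE \<omega> in P. Q (X i \<omega>)" if "i < n" for i
  proof (rule AE_distrD[where P = Q])
    show "X i \<in> P \<rightarrow>\<^sub>M \<mu>" using assms(2) that by (simp add: indep_vars_def)
    show "AE x in distr P \<mu> (X i). Q x" unfolding assms(3)[OF that] by (fact assms(4))
  qed
  then have "AE \<omega> in P. \<forall>i\<in>{..<n}. Q (X i \<omega>)" by (intro AE_finite_allI) auto
  then show ?thesis by eventually_elim simp
qed

theorem lemma6:
  fixes \<mu> :: "'x::metric_space measure"
    and l :: "'m::metric_space \<Rightarrow> 'x \<Rightarrow> real"
    and R :: "'m \<Rightarrow> ereal"
    and J0 :: ereal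
    and \<alpha> \<beta> \<tau> :: real
    and a :: "'x \<Rightarrow> 'x \<Rightarrow> real"
    and \<Upsilon> :: "'m set"
    and \<eta> \<kappa> \<iota> :: "nat \<Rightarrow> real"
    and P :: "'w measure"
    and X Y :: "nat \<Rightarrow> 'w \<Rightarrow> 'x"
    and n :: nat
  assumes prob_mu: "prob_space \<mu>" and borel_mu: "sets \<mu> = sets borel"
    and supp_mu: "measure \<mu> (supp \<mu>) = 1"
    and loss: "\<And>\<phi>. integrable \<mu> (l \<phi>)"
    and reg: "\<And>\<phi>. R \<phi> \<noteq> -\<infinity>"
    and A1: "proper (risk \<mu> l R)" "minimizers (risk \<mu> l R) \<noteq> {}"
    and A1_emp: "\<And>k. k \<ge> 1 \<Longrightarrow> AE x in sample_measure \<mu> k.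
                   proper (emp_risk l R k x) \<and> emp_minimizers l R k x \<noteq> {}"
    and A1_meas: "\<And>k. k \<ge> 1 \<Longrightarrow> \<exists>s \<in> sample_measure \<mu> k \<rightarrow>\<^sub>M borel.
                   AE x in sample_measure \<mu> k. s x \<in> emp_minimizers l R k x"
    and A2: "min_value (risk \<mu> l R) < J0" "\<beta> \<ge> 1" "\<tau> > 0"
            "\<And>\<phi>. risk \<mu> l R \<phi> \<le> J0 \<Longrightarrow>
               ereal \<tau> * epowr (dist_to \<phi> (minimizers (risk \<mu> l R))) \<beta>
                 \<le> risk \<mu> l R \<phi> - min_value (risk \<mu> l R)"
    and A3: "vanishing_prob \<mu>
               (\<lambda>k x. (SUP \<phi>\<in>emp_minimizers l R k x. risk \<mu> l R \<phi>) > J0) \<eta>"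
    and A4: "vanishing_prob \<mu> (\<lambda>k x. emp_growth \<mu> l R J0 \<beta> k x < ereal (\<tau> / 2)) \<kappa>"
    and A5: "\<alpha> > 0" "pseudometric a"
            "(\<lambda>(x, y). a x y) \<in> borel_measurable (\<mu> \<Otimes>\<^sub>M \<mu>)"
            "psi1_pseudometric \<mu> a < \<infinity>"
            "minimizers (risk \<mu> l R) \<subseteq> \<Upsilon>"
            "\<exists>N \<in> null_sets \<mu>. \<forall>x. \<forall>y. x \<notin> N \<longrightarrow> y \<notin> N \<longrightarrow> (\<forall>\<phi>\<in>\<Upsilon>. \<forall>\<psi>\<in>\<Upsilon>.
               l \<phi> x - l \<psi> x - l \<phi> y + l \<psi> y \<le> a x y * dist \<phi> \<psi> powr \<alpha>)"
            "vanishing_prob \<mu> (\<lambda>k x. \<not> emp_minimizers l R k x \<subseteq> \<Upsilon>) \<iota>"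
    and exponents: "\<beta> > \<alpha>"
    and prob_P: "prob_space P"
    and size: "n \<ge> 1"
    and X_iid: "prob_space.indep_vars P (\<lambda>_. \<mu>) X {..<n}" "\<And>i. i < n \<Longrightarrow> distr P \<mu> (X i) = \<mu>"
    and Y_iid: "prob_space.indep_vars P (\<lambda>_. \<mu>) Y {..<n}" "\<And>i. i < n \<Longrightarrow> distr P \<mu> (Y i) = \<mu>"
  shows "AE \<omega> in P.
           (\<lambda>i\<in>{..<n}. X i \<omega>) \<in> good_samples \<mu> l R J0 \<beta> \<tau> \<Upsilon> n \<and>
           (\<lambda>i\<in>{..<n}. Y i \<omega>) \<in> good_samples \<mu> l R J0 \<beta> \<tau> \<Upsilon> n \<longrightarrow>
           epowr (excess (emp_minimizers l R n (\<lambda>i\<in>{..<n}. Y i \<omega>))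
                         (emp_minimizers l R n (\<lambda>i\<in>{..<n}. X i \<omega>))) (\<beta> - \<alpha>)
             \<le> ereal (2 / \<tau> * ((1 / real n) * (\<Sum>i<n. a (X i \<omega>) (Y i \<omega>))))"
proof -
  interpret mu: prob_space \<mu> by (fact prob_mu)
  \<comment> \<open>The exceptional set \<open>N\<close> is the same for all \<open>\<phi>\<close>
    and \<open>\<psi>\<close>, so keeping the coordinates out of it yields the inequality for
    possibly uncountably many pairs at once.\<close>
  obtain N where N: "N \<in> null_sets \<mu>" and lip: "\<And>x y \<phi> \<psi>. x \<notin> N \<Longrightarrow> y \<notin> N \<Longrightarrow> \<phi> \<in> \<Upsilon> \<Longrightarrow> \<psi> \<in> \<Upsilon> \<Longrightarrow>
      l \<phi> x - l \<psi> x - l \<phi> y + l \<psi> y \<le> a x y * dist \<phi> \<psi> powr \<alpha>"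
    using A5(6) by blast
  have AE_N: "AE x in \<mu>. x \<notin> N" using N by (rule AE_not_in)
  have AE_supp: "AE x in \<mu>. x \<in> supp \<mu>"
    using supp_mu by (rule mu.AE_prob_1)
  have a_nonneg: "\<And>x y. 0 \<le> a x y" using A5(2) by (simp add: pseudometric_def)
  have min_X: "AE \<omega> in P. proper (emp_risk l R n (\<lambda>i\<in>{..<n}. X i \<omega>)) \<and>
      emp_minimizers l R n (\<lambda>i\<in>{..<n}. X i \<omega>) \<noteq> {}"
    by (rule AE_sample[OF prob_P size X_iid A1_emp[OF size]])
  have min_Y: "AE \<omega> in P. proper (emp_risk l R n (\<lambda>i\<in>{..<n}. Y i \<omega>)) \<and>
      emp_minimizers l R n (\<lambda>i\<in>{..<n}. Y i \<omega>) \<noteq> {}"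
    by (rule AE_sample[OF prob_P size Y_iid A1_emp[OF size]])
  have X_N: "AE \<omega> in P. \<forall>i<n. X i \<omega> \<notin> N"
    by (rule AE_sample_component[OF prob_P X_iid AE_N])
  have Y_N: "AE \<omega> in P. \<forall>i<n. Y i \<omega> \<notin> N"
    by (rule AE_sample_component[OF prob_P Y_iid AE_N])
  have Y_supp: "AE \<omega> in P. \<forall>i<n. Y i \<omega> \<in> supp \<mu>"
    by (rule AE_sample_component[OF prob_P Y_iid AE_supp])
  show ?thesis
    \<comment> \<open>Each of these events concerns one sample alone, so they can be intersected
      whatever the joint law of \<open>X\<close> and \<open>Y\<close>.\<close>
    using min_X min_Y X_N Y_N Y_supp
  proof eventually_elim
    case (elim \<omega>)
    show ?case
    proof (intro impI, elim conjE)
      let ?x = "\<lambda>i\<in>{..<n}. X i \<omega>" and ?y = "\<lambda>i\<in>{..<n}. Y i \<omega>"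
      assume good: "?x \<in> good_samples \<mu> l R J0 \<beta> \<tau> \<Upsilon> n" "?y \<in> good_samples \<mu> l R J0 \<beta> \<tau> \<Upsilon> n"
      have "epowr (excess (emp_minimizers l R n ?y) (emp_minimizers l R n ?x)) (\<beta> - \<alpha>)
        \<le> ereal (2 / \<tau> * ((1 / real n) * (\<Sum>i<n. a (?x i) (?y i))))"
      proof (rule excess_emp_minimizers_le[OF good])
        show "?y \<in> (\<Pi>\<^sub>E i\<in>{..<n}. supp \<mu>)" using elim by auto
      next
        fix i \<phi> \<psi> assume "i < n" "\<phi> \<in> \<Upsilon>" "\<psi> \<in> \<Upsilon>"
        then show "l \<phi> (?x i) - l \<psi> (?x i) - l \<phi> (?y i) + l \<psi> (?y i) \<le> a (?x i) (?y i) * dist \<phi> \<psi> powr \<alpha>"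
          using elim by (simp add: lip)
      qed (use elim reg A5(1) exponents A2(3) a_nonneg in auto)
      then show "epowr (excess (emp_minimizers l R n ?y) (emp_minimizers l R n ?x)) (\<beta> - \<alpha>)
        \<le> ereal (2 / \<tau> * ((1 / real n) * (\<Sum>i<n. a (X i \<omega>) (Y i \<omega>))))"
        by simp
    qed
  qed
qed

end
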